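(* For every $C>0$ there is a constant $C''>0$ depending only on $C$ such that for every positive integer $n$, every $C$-dense $n$-element point set $P$ in the plane admits a stacking order $f$ of $\mathcal{D}(P)$ with $$\mathrm{vis}(\mathcal{D}(P),f)\ge C'' n^{2/3}.$$
   Context: For a point $p$ in the plane, $D(p)$ denotes the closed disk of radius $1$ centered at $p$, and for a finite point set $P$, $\mathcal{D}(P)=\{D(p): p\in P\}$. A stacking order of a finite collection $\mathcal{D}$ of $n$ distinct unit disks is a bijection $f:\mathcal{D}\to\{1,\dots,n\}$; $f(D)$ is regarded as the height of $D$, and the arrangement is viewed from below. A point $x$ on the boundary circle of $D\in\mathcal{D}$ is visible if $x$ does not lie in any disk $D'\in\mathcal{D}$ with $f(D')<f(D)$. The visible perimeter $\mathrm{vis}(\mathcal{D},f)$ is the total length of all visible boundary points, summed over all disks of $\mathcal{D}$. An $n$-element point set $P$ is $C$-dense if $\max\{|pq|: p,q\in P\}\,/\,\min\{|pq|: p,q\in P,\ p\ne q\}\le C n^{1/2}$. *)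

theory Defs
  imports "HOL-Analysis.Analysis"
begin

definition unit_disk :: "complex \<Rightarrow> complex set" where
  "unit_disk p = cball p 1"

text \<open>Stacking orders: a disk D(p) is identified with its centre p (distinct points give
distinct disks), so a stacking order is a bijection f from P onto {1..n}.\<close>

definition stacking_order :: "complex set \<Rightarrow> (complex \<Rightarrow> nat) \<Rightarrow> bool" where
  "stacking_order P f \<longleftrightarrow> bij_betw f P {1..card P}"

definition visible :: "complex set \<Rightarrow> (complex \<Rightarrow> nat) \<Rightarrow> complex \<Rightarrow> complex \<Rightarrow> bool" where
  "visible P f p x \<longleftrightarrow> (\<forall>q\<in>P. f q < f p \<longrightarrow> x \<notin> unit_disk q)"

text \<open>Visible perimeter: the boundary circle of D(p) is parametrised by arc length
theta in [0, 2 pi) via p + cis theta (radius 1), so the length of the visible boundary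
is the Lebesgue measure of the set of visible parameters.\<close>

definition vis :: "complex set \<Rightarrow> (complex \<Rightarrow> nat) \<Rightarrow> real" where
  "vis P f = (\<Sum>p\<in>P. measure lborel {\<theta>::real. \<theta> \<in> {0..<2*pi} \<and> visible P f p (p + cis \<theta>)})"

definition C_dense :: "real \<Rightarrow> complex set \<Rightarrow> bool" where
  "C_dense C P \<longleftrightarrow>
     Max {dist p q | p q. p \<in> P \<and> q \<in> P} / Min {dist p q | p q. p \<in> P \<and> q \<in> P \<and> p \<noteq> q}
       \<le> C * sqrt (real (card P))"

end

theory Submission
  imports Defs
begin

text \<open>
  Stack the disks by increasing distance of their centres from a point \<open>c\<close>, at distance
  comparable to the diameter \<open>\<Delta>\<close> of \<open>P\<close>. If a lower disk \<open>D(q)\<close> covers a boundary point of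
  \<open>D(p)\<close> whose direction makes an angle at most \<open>\<phi>\<close> with \<open>p - c\<close>, then \<open>q\<close> lies in a thin
  circular cap: \<open>|q - p| = O(\<Delta> \<phi>)\<close>, and \<open>q - p\<close> is orthogonal to \<open>p - c\<close> up to an angle
  \<open>O(\<phi>)\<close>. Only the half-plane bounded by the tangent is used, which is why the size of the
  unit disks relative to \<open>P\<close> is irrelevant. Let \<open>c\<close> range over a segment at distance about
  \<open>2 \<Delta>\<close> from \<open>P\<close>. Density allows \<open>O(1 + n \<phi>\<^sup>2)\<close> candidates \<open>q\<close> for each \<open>p\<close>, and each of
  them is nearly orthogonal for a fraction \<open>O(\<phi>)\<close> of the positions of \<open>c\<close>. For
  \<open>\<phi> = \<epsilon> n powr (-1/3)\<close> with small \<open>\<epsilon>\<close>, some \<open>c\<close> therefore leaves at least half of the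
  points \<open>p\<close> without such a \<open>q\<close>, and each of these contributes visible length at least \<open>\<phi>\<close>.
\<close>

section \<open>Stacking by a key, and counting bounds\<close>

text \<open>The induction adds a point of maximal key, which takes the top height. Equal keys may be
  ordered either way, hence the weak inequality.\<close>

lemma ex_stacking_order_by_key:
  fixes g :: "complex \<Rightarrow> real"
  assumes "finite P"
  shows "\<exists>f. stacking_order P f \<and> (\<forall>p\<in>P. \<forall>q\<in>P. f q < f p \<longrightarrow> g q \<le> g p)"
  using assms
proof (induction P rule: finite_ranking_induct[where f = g])
  case empty
  then show ?case by (auto simp: stacking_order_def bij_betw_def)
next
  case (insert x S)
  show ?case
  proof (cases "x \<in> S")
    case True
    with insert show ?thesis by (simp add: insert_absorb)
  next
    case False
    from insert obtain f where f: "bij_betw f S {1..card S}"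
      "\<forall>p\<in>S. \<forall>q\<in>S. f q < f p \<longrightarrow> g q \<le> g p"
      by (auto simp: stacking_order_def)
    define f' where "f' = f(x := Suc (card S))"
    have "bij_betw f' S {1..card S}"
      using f(1) False by (subst bij_betw_cong[of _ _ f]) (auto simp: f'_def)
    then have "bij_betw f' (S \<union> {x}) ({1..card S} \<union> {f' x})"
      using False by (intro notIn_Un_bij_betw) (auto simp: f'_def)
    moreover have "{1..card S} \<union> {f' x} = {1..card (insert x S)}"
      using insert.hyps False by (auto simp: f'_def)
    ultimately have 1: "stacking_order (insert x S) f'"
      by (simp add: stacking_order_def)
    have le: "f q \<le> card S" if "q \<in> S" for q
      using f(1) that by (auto dest!: bij_betwE)
    have "g q \<le> g p" if "p \<in> insert x S" "q \<in> insert x S" "f' q < f' p" for p q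
    proof -
      have "q \<noteq> x"
        using that le[of p] by (auto simp: f'_def split: if_splits)
      then show ?thesis
        using that f(2) insert.hyps by (auto simp: f'_def split: if_splits)
    qed
    with 1 show ?thesis by blast
  qed
qed

lemma card_nats_in_interval_le:
  fixes s h :: real
  assumes "A \<subseteq> {k::nat. \<bar>real k - s\<bar> \<le> h}" "0 \<le> h"
  shows "real (card A) \<le> 2 * h + 1"
proof -
  have "int ` A \<subseteq> {\<lceil>s - h\<rceil>..\<lfloor>s + h\<rfloor>}"
  proof
    fix i assume "i \<in> int ` A"
    then obtain k where k: "i = int k" "\<bar>real k - s\<bar> \<le> h"
      using assms by blast
    then have "s - h \<le> of_int i" "of_int i \<le> s + h" by auto
    then show "i \<in> {\<lceil>s - h\<rceil>..\<lfloor>s + h\<rfloor>}"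
      by (simp add: ceiling_le_iff le_floor_iff)
  qed
  then have "card (int ` A) \<le> card {\<lceil>s - h\<rceil>..\<lfloor>s + h\<rfloor>}"
    by (intro card_mono) auto
  then have "card A \<le> nat (\<lfloor>s + h\<rfloor> - \<lceil>s - h\<rceil> + 1)"
    by (simp add: card_image)
  moreover have "real (nat (\<lfloor>s + h\<rfloor> - \<lceil>s - h\<rceil> + 1)) \<le> 2 * h + 1"
    using assms(2) by linarith
  ultimately show ?thesis by linarith
qed

text \<open>In a grid of cells of side \<delta>/2 each cell holds at most one point of
  \<open>P\<close>, since the coordinate differences within a cell add up to less than \<delta>. The
  disk spans at most 4s/\<delta> + 2 columns and as many rows.\<close>

lemma card_separated_points_le:
  fixes P :: "complex set" and \<delta> s :: real
  assumes "finite P" "\<delta> > 0" "s \<ge> 0"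
    and sep: "\<And>p q. p \<in> P \<Longrightarrow> q \<in> P \<Longrightarrow> p \<noteq> q \<Longrightarrow> \<delta> \<le> dist p q"
  shows "real (card {q \<in> P. cmod (q - p) \<le> s}) \<le> (4 * s / \<delta> + 2)\<^sup>2"
proof -
  let ?A = "{q \<in> P. cmod (q - p) \<le> s}"
  let ?I = "\<lambda>x. {\<lfloor>2 * (x - s) / \<delta>\<rfloor>..\<lfloor>2 * (x + s) / \<delta>\<rfloor>}"
  define F where "F q = (\<lfloor>2 * Re q / \<delta>\<rfloor>, \<lfloor>2 * Im q / \<delta>\<rfloor>)" for q
  have close: "\<bar>x - y\<bar> < \<delta> / 2" if "\<lfloor>2 * x / \<delta>\<rfloor> = \<lfloor>2 * y / \<delta>\<rfloor>" for x y
  proof -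
    have "\<bar>2 * x / \<delta> - 2 * y / \<delta>\<bar> < 1" using that by linarith
    also have "2 * x / \<delta> - 2 * y / \<delta> = (x - y) * (2 / \<delta>)"
      using \<open>\<delta> > 0\<close> by (simp add: field_simps)
    finally have "\<bar>x - y\<bar> * 2 < \<delta>"
      using \<open>\<delta> > 0\<close> by (simp add: abs_mult pos_divide_less_eq del: left_diff_distrib_numeral)
    then show ?thesis by simp
  qed
  have "inj_on F ?A"
  proof (rule inj_onI, rule ccontr)
    fix x y assume xy: "x \<in> ?A" "y \<in> ?A" "F x = F y" "x \<noteq> y"
    have "dist x y \<le> \<bar>Re x - Re y\<bar> + \<bar>Im x - Im y\<bar>"
      using cmod_le[of "x - y"] by (simp add: dist_norm)
    also have "\<dots> < \<delta>"
      using close[of "Re x" "Re y"] close[of "Im x" "Im y"] xy by (simp add: F_def)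
    finally show False using sep xy by fastforce
  qed
  moreover have "F ` ?A \<subseteq> ?I (Re p) \<times> ?I (Im p)"
  proof
    fix z assume "z \<in> F ` ?A"
    then obtain q where q: "cmod (q - p) \<le> s" "z = F q" by auto
    have "\<bar>Re q - Re p\<bar> \<le> s" "\<bar>Im q - Im p\<bar> \<le> s"
      using abs_Re_le_cmod[of "q - p"] abs_Im_le_cmod[of "q - p"] q by auto
    then show "z \<in> ?I (Re p) \<times> ?I (Im p)"
      using \<open>\<delta> > 0\<close> by (auto simp: q F_def intro!: floor_mono divide_right_mono)
  qed
  ultimately have "card ?A \<le> card (?I (Re p) \<times> ?I (Im p))"
    by (intro card_inj_on_le[of F]) auto
  then have *: "real (card ?A) \<le> real (card (?I (Re p))) * real (card (?I (Im p)))"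
    by (simp only: card_cartesian_product of_nat_le_iff flip: of_nat_mult)
  have I: "real (card (?I x)) \<le> 4 * s / \<delta> + 2" for x
  proof -
    have "2 * (x + s) / \<delta> - 2 * (x - s) / \<delta> = 4 * s / \<delta>"
      by (simp add: algebra_simps diff_divide_distrib add_divide_distrib)
    moreover have "0 \<le> 4 * s / \<delta>" using assms by simp
    ultimately show ?thesis
      unfolding card_atLeastAtMost_int by linarith
  qed
  have "real (card (?I (Re p))) * real (card (?I (Im p))) \<le> (4 * s / \<delta> + 2) * (4 * s / \<delta> + 2)"
    using I[of "Re p"] I[of "Im p"] by (intro mult_mono) auto
  with * show ?thesis by (simp add: power2_eq_square)
qed

section \<open>Geometry of a covered boundary point\<close>

text \<open>Used with \<open>v = p - c\<close>, \<open>w = q - p\<close> and \<open>u\<close> the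
  direction of the covered point. That \<open>q\<close> is no farther from \<open>c\<close> than
  \<open>p\<close> gives an upper bound on \<open>v \<bullet> w\<close>, quadratic in
  \<open>w\<close>. Covering forces \<open>0 \<le> u \<bullet> w\<close>, and \<open>u\<close> is
  close to \<open>sgn v\<close>, which gives a linear lower bound. Comparing the two bounds yields
  both claims.\<close>

lemma covered_near_direction:
  fixes v w u :: complex
  assumes "v \<noteq> 0" "cmod (v + w) \<le> cmod v" "cmod u = 1" "cmod (u - w) \<le> 1"
    and u: "cmod (u - sgn v) \<le> \<phi>"
  shows "cmod w \<le> 2 * cmod v * \<phi>" "\<bar>v \<bullet> w\<bar> \<le> \<phi> * cmod v * cmod w"
proof -
  have v: "v \<bullet> w = cmod v * (sgn v \<bullet> w)" 
    using \<open>v \<noteq> 0\<close> by (simp add: sgn_div_norm)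
  have "(cmod (v + w))\<^sup>2 \<le> (cmod v)\<^sup>2" using assms(2) by (simp add: power_mono)
  then have up: "2 * (v \<bullet> w) \<le> - (cmod w)\<^sup>2"
    by (simp add: power2_norm_eq_inner inner_simps inner_commute)
  have "(cmod (u - w))\<^sup>2 \<le> (cmod u)\<^sup>2" using assms by (intro power_mono) auto
  then have "w \<bullet> w \<le> 2 * (u \<bullet> w)"
    by (simp add: power2_norm_eq_inner inner_simps inner_commute)
  then have "0 \<le> u \<bullet> w" using inner_ge_zero[of w] by linarith
  also have "u \<bullet> w = (u - sgn v) \<bullet> w + sgn v \<bullet> w" by (simp add: inner_simps)
  also have "(u - sgn v) \<bullet> w \<le> \<phi> * cmod w"
    using norm_cauchy_schwarz[of "u - sgn v" w] mult_right_mono[OF u, of "cmod w"] by simp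
  finally have "- (\<phi> * cmod w) \<le> sgn v \<bullet> w" by simp
  then have "cmod v * - (\<phi> * cmod w) \<le> cmod v * (sgn v \<bullet> w)"
    by (intro mult_left_mono) auto
  then have lo: "- (\<phi> * cmod v * cmod w) \<le> v \<bullet> w"
    by (simp add: v algebra_simps)
  have "v \<bullet> w \<le> 0" using up zero_le_power2[of "cmod w"] by linarith
  with lo show "\<bar>v \<bullet> w\<bar> \<le> \<phi> * cmod v * cmod w" by linarith
  have "cmod w * cmod w \<le> (2 * cmod v * \<phi>) * cmod w"
    using lo up by (simp add: power2_eq_square algebra_simps)
  moreover have "0 \<le> \<phi>" using u norm_ge_zero order_trans by blast
  ultimately show "cmod w \<le> 2 * cmod v * \<phi>"
    by (cases "w = 0") (auto dest: mult_right_le_imp_le)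
qed

text \<open>The segment of centres is transversal to every line through a point of \<open>P\<close> that meets it,
so a vector \<open>w\<close> nearly orthogonal to \<open>a - c\<close> has a substantial component along the segment,
and the inner product varies at a definite rate with \<open>k\<close>.\<close>

lemma card_nearly_orthogonal_le:
  fixes a w :: complex and \<Delta> \<phi> :: real and m :: nat
  assumes "\<Delta> > 0" "w \<noteq> 0" "cmod a \<le> \<Delta>" "0 < \<phi>" "\<phi> \<le> 1/8" "m > 0"
  shows "real (card {k. k < m \<and> \<bar>(a - Complex (\<Delta> * real k / real m) (- 2 * \<Delta>)) \<bullet> w\<bar> \<le> 4 * \<phi> * \<Delta> * cmod w})
     \<le> 64 * \<phi> * real m + 1" (is "real (card ?A) \<le> _")
proof (cases "?A = {}")
  case True
  show ?thesis unfolding True using assms by simp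
next
  case False
  define X where "X k = Re a - \<Delta> * real k / real m" for k
  define Y where "Y = Im a + 2 * \<Delta>"
  have inner: "(a - Complex (\<Delta> * real k / real m) (- 2 * \<Delta>)) \<bullet> w = X k * Re w + Y * Im w" for k
    by (simp add: inner_complex_def X_def Y_def)
  have Y: "\<Delta> \<le> Y" using abs_Im_le_cmod[of a] assms by (simp add: Y_def)
  have X: "\<bar>X k\<bar> \<le> 2 * \<Delta>" if "k < m" for k
  proof -
    have "0 \<le> \<Delta> * real k / real m" "\<Delta> * real k / real m \<le> \<Delta>"
      using that assms by (auto simp: field_simps)
    then show ?thesis using abs_Re_le_cmod[of a] assms(3) unfolding X_def by linarith
  qed
  have "cmod w > 0" using assms by simp
  \<comment> \<open>Otherwise, for some \<open>k\<close> in the set, the vertical term is at least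
    7/8 of \<open>\<Delta> * cmod w\<close>, while the horizontal term (at most 1/4) and the
    tolerance (at most 1/2, as \<phi> \<le> 1/8) cannot make up for it.\<close>
  have big: "cmod w / 8 \<le> \<bar>Re w\<bar>"
  proof (rule ccontr)
    assume "\<not> ?thesis"
    then have Re: "\<bar>Re w\<bar> < cmod w / 8" by simp
    then have Im: "7/8 * cmod w \<le> \<bar>Im w\<bar>" using cmod_le[of w] by linarith
    obtain k where k: "k < m" "\<bar>X k * Re w + Y * Im w\<bar> \<le> 4 * \<phi> * \<Delta> * cmod w"
      using False inner by auto
    have "\<bar>X k * Re w\<bar> \<le> 2 * \<Delta> * (cmod w / 8)"
      unfolding abs_mult using X[OF k(1)] Re assms by (intro mult_mono) auto
    moreover have "\<Delta> * (7/8 * cmod w) \<le> \<bar>Y * Im w\<bar>"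
      unfolding abs_mult using Y Im assms by (intro mult_mono) auto
    moreover have "4 * \<phi> * \<Delta> * cmod w \<le> 4 * (1/8) * \<Delta> * cmod w"
      using assms by (intro mult_right_mono) auto
    moreover have "0 < \<Delta> * cmod w" using assms by simp
    ultimately show False using k(2) by linarith
  qed
  then have Re0: "0 < \<bar>Re w\<bar>" using \<open>cmod w > 0\<close> by linarith
  \<comment> \<open>The inner product is affine in \<open>k\<close>; \<open>s\<close> is its real
    zero.\<close>
  define s where "s = (Re a + Y * Im w / Re w) * real m / \<Delta>"
  have "?A \<subseteq> {k. \<bar>real k - s\<bar> \<le> 32 * \<phi> * real m}"
  proof safe
    fix k assume "k < m"
      and "\<bar>(a - Complex (\<Delta> * real k / real m) (- 2 * \<Delta>)) \<bullet> w\<bar> \<le> 4 * \<phi> * \<Delta> * cmod w"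
    then have "\<bar>X k * Re w + Y * Im w\<bar> \<le> 4 * \<phi> * \<Delta> * cmod w" using inner by simp
    also have "\<dots> \<le> 4 * \<phi> * \<Delta> * (8 * \<bar>Re w\<bar>)"
      using big assms by (intro mult_left_mono) auto
    also have "X k * Re w + Y * Im w = (s - real k) * (\<Delta> / real m * Re w)"
      using assms Re0 by (simp add: X_def s_def field_simps)
    finally have "\<bar>s - real k\<bar> * (\<Delta> / real m * \<bar>Re w\<bar>) \<le> (32 * \<phi> * real m) * (\<Delta> / real m * \<bar>Re w\<bar>)"
      using assms by (simp add: abs_mult)
    moreover have "0 < \<Delta> / real m * \<bar>Re w\<bar>" using assms(1,6) Re0 by simp
    ultimately have "\<bar>s - real k\<bar> \<le> 32 * \<phi> * real m"
      by (rule mult_right_le_imp_le)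
    then show "\<bar>real k - s\<bar> \<le> 32 * \<phi> * real m" by linarith
  qed
  from card_nats_in_interval_le[OF this] show ?thesis using assms by simp
qed

section \<open>Visible length and the choice of a centre\<close>

text \<open>Monotonicity of \<open>measure\<close> needs the larger set to be measurable of finite
  measure: it is \<open>{0..<2*pi}\<close> minus finitely many closed sets.\<close>

lemma visible_measure_ge:
  assumes "finite P" "0 \<le> \<alpha>" "\<alpha> \<le> \<beta>" "\<beta> < 2 * pi"
    and vis: "\<And>\<theta>. \<alpha> \<le> \<theta> \<Longrightarrow> \<theta> \<le> \<beta> \<Longrightarrow> visible P f p (p + cis \<theta>)"
  shows "\<beta> - \<alpha> \<le> measure lborel {\<theta>::real. \<theta> \<in> {0..<2*pi} \<and> visible P f p (p + cis \<theta>)}"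
    (is "_ \<le> measure lborel ?V")
proof -
  let ?Q = "{q \<in> P. f q < f p}"
  have closed: "closed {\<theta>. cmod (q - (p + cis \<theta>)) \<le> 1}" for q
    by (intro closed_Collect_le continuous_intros)
  have "?V = {0..<2*pi} - (\<Union>q\<in>?Q. {\<theta>. cmod (q - (p + cis \<theta>)) \<le> 1})"
    by (auto simp: visible_def unit_disk_def dist_norm)
  also have "\<dots> \<in> sets lborel"
    using assms(1) borel_closed[OF closed] by (intro sets.Diff sets.finite_UN) auto
  finally have "?V \<in> sets lborel" .
  moreover have "?V \<subseteq> {0..2*pi}" by auto
  moreover have "{0..2*pi} \<in> fmeasurable lborel" by (simp add: fmeasurable_compact)
  ultimately have V: "?V \<in> fmeasurable lborel" by (blast intro: fmeasurableI2)
  have "{\<alpha>..\<beta>} \<subseteq> ?V" using assms by auto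
  then have "measure lborel {\<alpha>..\<beta>} \<le> measure lborel ?V"
    by (rule measure_mono_fmeasurable[OF _ _ V]) simp
  then show ?thesis using assms by simp
qed

text \<open>Double counting of bad pairs of a point and a centre. In \<open>small\<close>, the
  square bounds the candidates \<open>q\<close> per point, and 65\<phi> the fraction of centres that
  each of them spoils.\<close>

lemma ex_stacking_order_vis_ge:
  fixes P :: "complex set" and \<delta> \<Delta> \<phi> :: real
  assumes "finite P" "P \<noteq> {}" "0 < \<delta>" "0 < \<Delta>" "0 < \<phi>" "\<phi> \<le> 1/8"
    and sep: "\<And>p q. p \<in> P \<Longrightarrow> q \<in> P \<Longrightarrow> p \<noteq> q \<Longrightarrow> \<delta> \<le> dist p q"
    and diam: "\<And>p q. p \<in> P \<Longrightarrow> q \<in> P \<Longrightarrow> dist p q \<le> \<Delta>"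
    and small: "65 * \<phi> * (32 * \<phi> * \<Delta> / \<delta> + 2)\<^sup>2 \<le> 1/2"
  shows "\<exists>f. stacking_order P f \<and> real (card P) * \<phi> / 2 \<le> vis P f"
proof -
  obtain p0 where p0: "p0 \<in> P" using assms by auto
  \<comment> \<open>Enough sample centres for the rounding error 1 in the count to be at most
    \<open>\<phi> * real m\<close>, turning 64 into 65.\<close>
  obtain m :: nat where m: "1 / \<phi> < real m" using reals_Archimedean2 by blast
  have m0: "m > 0" using m assms by (metis less_asym of_nat_0 of_nat_0_less_iff zero_less_divide_1_iff gr0I)
  have m1: "1 \<le> \<phi> * real m" using m assms by (simp add: field_simps)
  define O' where "O' k = Complex (\<Delta> * real k / real m) (- 2 * \<Delta>)" for k
  \<comment> \<open>The constants 8 and 4 come from |p - c| \<le> 4\<Delta>: the centres are within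
    3\<Delta> of \<open>p0\<close>, and \<open>p\<close> within \<Delta>. \<open>B p k\<close> marks
    centre \<open>k\<close> as possibly bad for \<open>p\<close>.\<close>
  define N where "N p = {q \<in> P. cmod (q - p) \<le> 8 * \<Delta> * \<phi>} - {p}" for p
  define B where "B p k \<longleftrightarrow> (\<exists>q\<in>N p. \<bar>(p - p0 - O' k) \<bullet> (q - p)\<bar> \<le> 4 * \<phi> * \<Delta> * cmod (q - p))" for p k
  have finN: "finite (N p)" for p using assms by (simp add: N_def)
  have few: "real (card {k. k < m \<and> B p k}) \<le> real m / 2" if p: "p \<in> P" for p
  proof -
    have "{k. k < m \<and> B p k} = (\<Union>q\<in>N p. {k. k < m \<and> \<bar>(p - p0 - O' k) \<bullet> (q - p)\<bar> \<le> 4 * \<phi> * \<Delta> * cmod (q - p)})"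
      (is "_ = (\<Union>q\<in>_. ?S q)")
      by (auto simp: B_def)
    then have "card {k. k < m \<and> B p k} \<le> (\<Sum>q\<in>N p. card (?S q))"
      using card_UN_le[OF finN] by simp
    then have "real (card {k. k < m \<and> B p k}) \<le> (\<Sum>q\<in>N p. real (card (?S q)))"
      by (simp flip: of_nat_sum)
    also have "\<dots> \<le> (\<Sum>q\<in>N p. 65 * \<phi> * real m)"
    proof (rule sum_mono)
      fix q assume "q \<in> N p"
      then have "real (card (?S q)) \<le> 64 * \<phi> * real m + 1"
        unfolding O'_def using assms m0 diam[OF p p0]
        by (intro card_nearly_orthogonal_le) (auto simp: N_def dist_norm)
      then show "real (card (?S q)) \<le> 65 * \<phi> * real m" using m1 by linarith
    qed
    also have "\<dots> = real (card (N p)) * (65 * \<phi> * real m)" by simp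
    also have "\<dots> \<le> (32 * \<phi> * \<Delta> / \<delta> + 2)\<^sup>2 * (65 * \<phi> * real m)"
    proof (rule mult_right_mono)
      have "card (N p) \<le> card {q \<in> P. cmod (q - p) \<le> 8 * \<Delta> * \<phi>}"
        using assms by (intro card_mono) (auto simp: N_def)
      also have "real \<dots> \<le> (4 * (8 * \<Delta> * \<phi>) / \<delta> + 2)\<^sup>2"
        using assms by (intro card_separated_points_le) auto
      finally show "real (card (N p)) \<le> (32 * \<phi> * \<Delta> / \<delta> + 2)\<^sup>2" by (simp add: mult_ac)
    qed (use assms in auto)
    also have "\<dots> = (65 * \<phi> * (32 * \<phi> * \<Delta> / \<delta> + 2)\<^sup>2) * real m" by simp
    also have "\<dots> \<le> 1/2 * real m" using small by (intro mult_right_mono) auto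
    finally show ?thesis by simp
  qed
  \<comment> \<open>If every centre were bad for more than half of \<open>P\<close>, summing over
    centres would contradict \<open>few\<close> summed over points.\<close>
  have "\<exists>k<m. real (card {p \<in> P. B p k}) \<le> real (card P) / 2"
  proof (rule ccontr)
    assume "\<not> ?thesis"
    then have "(\<Sum>k<m. real (card P) / 2) < (\<Sum>k<m. real (card {p \<in> P. B p k}))"
      using m0 by (intro sum_strict_mono) auto
    also have "\<dots> = (\<Sum>k<m. \<Sum>p\<in>P. of_bool (B p k))"
      using assms by (simp add: Int_def)
    also have "\<dots> = (\<Sum>p\<in>P. \<Sum>k<m. of_bool (B p k))" by (rule sum.swap)
    also have "\<dots> = (\<Sum>p\<in>P. real (card {k. k < m \<and> B p k}))"
      by (simp add: Int_def)
    also have "\<dots> \<le> (\<Sum>p\<in>P. real m / 2)" by (intro sum_mono few)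
    finally show False by simp
  qed
  then obtain k where k: "k < m" "real (card {p \<in> P. B p k}) \<le> real (card P) / 2" by blast
  define c where "c = p0 + O' k"
  obtain f where f: "stacking_order P f"
    and ord: "\<And>p q. p \<in> P \<Longrightarrow> q \<in> P \<Longrightarrow> f q < f p \<Longrightarrow> cmod (q - c) \<le> cmod (p - c)"
    using ex_stacking_order_by_key[OF assms(1), of "\<lambda>p. cmod (p - c)"] by blast
  have good: "\<phi> \<le> measure lborel {\<theta>::real. \<theta> \<in> {0..<2*pi} \<and> visible P f p (p + cis \<theta>)}"
    if p: "p \<in> P" and nB: "\<not> B p k" for p
  proof -
    define v where "v = p - c"
    have a: "cmod (p - p0) \<le> \<Delta>" using diam[OF p p0] by (simp add: dist_norm)
    have Imv: "0 < Im v"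
      using abs_Im_le_cmod[of "p - p0"] a \<open>0 < \<Delta>\<close> by (simp add: v_def c_def O'_def)
    then have v0: "v \<noteq> 0" by auto
    have "cmod (O' k) \<le> \<bar>\<Delta> * real k / real m\<bar> + \<bar>- 2 * \<Delta>\<bar>"
      using cmod_le[of "O' k"] by (simp add: O'_def)
    moreover have "0 \<le> \<Delta> * real k / real m" "\<Delta> * real k / real m \<le> \<Delta>"
      using k assms by (auto simp: field_simps)
    ultimately have "cmod (O' k) \<le> 3 * \<Delta>" using \<open>0 < \<Delta>\<close> by simp
    then have vle: "cmod v \<le> 4 * \<Delta>"
      using norm_triangle_ineq4[of "p - p0" "O' k"] a by (simp add: v_def c_def algebra_simps)
    \<comment> \<open>Since \<open>c\<close> lies below all of \<open>P\<close>, the arc from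
      \<open>Arg v\<close> to \<open>Arg v + \<phi>\<close> does not wrap around in the parameter
      interval.\<close>
    have Arg: "0 < Arg v" "Arg v < pi" using Imv Arg_lt_pi by auto
    have "visible P f p (p + cis \<theta>)" if \<theta>: "Arg v \<le> \<theta>" "\<theta> \<le> Arg v + \<phi>" for \<theta>
      unfolding visible_def
    proof (intro ballI impI notI)
      fix q assume q: "q \<in> P" "f q < f p" and cov: "p + cis \<theta> \<in> unit_disk q"
      have "cis \<theta> - sgn v = cis (Arg v) * (cis (\<theta> - Arg v) - 1)"
        using v0 by (simp add: cis_Arg algebra_simps cis_mult flip: cis_Arg)
      then have "cmod (cis \<theta> - sgn v) = 2 * \<bar>sin ((\<theta> - Arg v) / 2)\<bar>"
        using dist_exp_i_1[of "\<theta> - Arg v"] by (simp add: norm_mult cis_conv_exp)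
      also have "\<dots> \<le> \<phi>" using abs_sin_x_le_abs_x[of "(\<theta> - Arg v) / 2"] \<theta> by auto
      finally have u: "cmod (cis \<theta> - sgn v) \<le> \<phi>" .
      have "cmod (v + (q - p)) \<le> cmod v" using ord[OF p q] by (simp add: v_def)
      moreover have "cmod (cis \<theta> - (q - p)) \<le> 1"
        using cov by (simp add: unit_disk_def dist_norm norm_minus_commute algebra_simps)
      ultimately have near: "cmod (q - p) \<le> 2 * cmod v * \<phi>"
        and orth: "\<bar>v \<bullet> (q - p)\<bar> \<le> \<phi> * cmod v * cmod (q - p)"
        using covered_near_direction[OF v0 _ _ _ u, of "q - p"] by auto
      have "2 * cmod v * \<phi> \<le> 2 * (4 * \<Delta>) * \<phi>"
        using vle assms by (intro mult_right_mono) auto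
      with near have "cmod (q - p) \<le> 8 * \<Delta> * \<phi>" by linarith
      with q have "q \<in> N p" by (auto simp: N_def)
      moreover have "\<phi> * cmod v * cmod (q - p) \<le> \<phi> * (4 * \<Delta>) * cmod (q - p)"
        using vle assms by (intro mult_right_mono mult_left_mono) auto
      ultimately have "B p k"
        using orth unfolding B_def v_def c_def by (intro bexI[of _ q]) (auto simp: diff_diff_eq)
      with nB show False ..
    qed
    then have "Arg v + \<phi> - Arg v \<le> measure lborel {\<theta>::real. \<theta> \<in> {0..<2*pi} \<and> visible P f p (p + cis \<theta>)}"
      using assms Arg pi_gt3 by (intro visible_measure_ge) auto
    then show ?thesis by simp
  qed
  have "real (card P) / 2 \<le> real (card {p \<in> P. \<not> B p k})"
  proof -
    have "card P = card ({p \<in> P. B p k} \<union> {p \<in> P. \<not> B p k})"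
      by (rule arg_cong[of _ _ card]) auto
    also have "\<dots> = card {p \<in> P. B p k} + card {p \<in> P. \<not> B p k}"
      using assms by (intro card_Un_disjoint) auto
    finally show ?thesis using k(2) by linarith
  qed
  then have "real (card P) / 2 * \<phi> \<le> real (card {p \<in> P. \<not> B p k}) * \<phi>"
    using assms by (intro mult_right_mono) auto
  also have "\<dots> = (\<Sum>p\<in>{p \<in> P. \<not> B p k}. \<phi>)" by simp
  also have "\<dots> \<le> (\<Sum>p\<in>{p \<in> P. \<not> B p k}. measure lborel {\<theta>::real. \<theta> \<in> {0..<2*pi} \<and> visible P f p (p + cis \<theta>)})"
    using good by (intro sum_mono) auto
  also have "\<dots> \<le> vis P f"
    unfolding vis_def using assms by (intro sum_mono2) auto
  finally show ?thesis using f by (intro exI[of _ f]) simp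
qed

section \<open>Density and the choice of parameters\<close>

text \<open>Two points make the set under \<open>Min\<close> nonempty and its minimum positive, so
  the quotient can be cleared.\<close>

lemma C_dense_bounds:
  assumes "finite P" "card P \<ge> 2" "C_dense C P"
  obtains \<delta> \<Delta> where "0 < \<delta>" "0 < \<Delta>" "\<Delta> \<le> C * sqrt (real (card P)) * \<delta>"
    "\<And>p q. p \<in> P \<Longrightarrow> q \<in> P \<Longrightarrow> p \<noteq> q \<Longrightarrow> \<delta> \<le> dist p q"
    "\<And>p q. p \<in> P \<Longrightarrow> q \<in> P \<Longrightarrow> dist p q \<le> \<Delta>"
proof -
  let ?A = "{dist p q | p q. p \<in> P \<and> q \<in> P}"
  let ?B = "{dist p q | p q. p \<in> P \<and> q \<in> P \<and> p \<noteq> q}"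
  have "?A = (\<lambda>(p, q). dist p q) ` (P \<times> P)" by auto
  then have finA: "finite ?A" using assms by simp
  have finB: "finite ?B" by (rule finite_subset[OF _ finA]) auto
  have "\<not> is_singleton P" "P \<noteq> {}" using assms(2) by (auto simp: is_singleton_altdef)
  then obtain x y where xy: "x \<in> P" "y \<in> P" "x \<noteq> y"
    by (metis is_singletonI' all_not_in_conv)
  then have "?B \<noteq> {}" by blast
  then have "Min ?B \<in> ?B" using finB by (rule Min_in[rotated])
  then have pos: "0 < Min ?B" by auto
  have min: "Min ?B \<le> dist p q" if "p \<in> P" "q \<in> P" "p \<noteq> q" for p q
    using that finB by (intro Min_le) auto
  have max: "dist p q \<le> Max ?A" if "p \<in> P" "q \<in> P" for p q
    using that finA by (intro Max_ge) auto
  have "0 < Max ?A" using max[OF xy(1,2)] xy(3) by (meson less_le_trans zero_less_dist_iff)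
  moreover have "Max ?A \<le> C * sqrt (real (card P)) * Min ?B"
    using assms(3) pos unfolding C_dense_def by (simp add: pos_divide_le_eq)
  ultimately show ?thesis using that[OF pos _ _ min max] by blast
qed

theorem theorem4:
  "\<forall>C::real. C > 0 \<longrightarrow> (\<exists>C''::real. C'' > 0 \<and>
     (\<forall>(n::nat) (P::complex set). n > 0 \<longrightarrow> finite P \<longrightarrow> card P = n \<longrightarrow> C_dense C P \<longrightarrow>
        (\<exists>f. stacking_order P f \<and> vis P f \<ge> C'' * real n powr (2/3))))"
proof (intro allI impI)
  fix C :: real assume "C > 0"
  \<comment> \<open>With 1/(32C) the term 32\<phi>\<Delta>/\<delta> is at most n^(1/6); 1170 is
    twice 585 = 65 * 9, which gives the bound 1/2 in \<open>small\<close>.\<close>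
  define c where "c = min (1/1170) (1 / (32 * C))"
  have c: "0 < c" "c \<le> 1/1170" "c \<le> 1 / (32 * C)" using \<open>C > 0\<close> by (auto simp: c_def)
  then have cC: "32 * c * C \<le> 1" using \<open>C > 0\<close> by (simp add: field_simps)
  have "\<exists>f. stacking_order P f \<and> vis P f \<ge> c / 2 * real n powr (2/3)"
    if n: "n > 0" "finite P" "card P = n" "C_dense C P" for n and P :: "complex set"
  proof (cases "n = 1")
    case True
    then obtain p where P: "P = {p}" using n by (auto simp: card_1_singleton_iff)
    \<comment> \<open>A lone circle is entirely visible; the arc [0,2] already suffices.\<close>
    have "2 - 0 \<le> measure lborel {\<theta>::real. \<theta> \<in> {0..<2*pi} \<and> visible P (\<lambda>_. 1) p (p + cis \<theta>)}"
      using n pi_gt3 by (intro visible_measure_ge) (auto simp: visible_def)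
    then have "c / 2 * real n powr (2/3) \<le> vis P (\<lambda>_. 1)"
      using c True by (simp add: vis_def P)
    moreover have "stacking_order P (\<lambda>_. 1)" by (simp add: stacking_order_def P bij_betw_def)
    ultimately show ?thesis by blast
  next
    case False
    then have "card P \<ge> 2" using n by simp
    from C_dense_bounds[OF n(2) this n(4)] obtain \<delta> \<Delta> where D: "0 < \<delta>" "0 < \<Delta>"
      "\<Delta> \<le> C * sqrt (real n) * \<delta>"
      and sep: "\<And>p q. p \<in> P \<Longrightarrow> q \<in> P \<Longrightarrow> p \<noteq> q \<Longrightarrow> \<delta> \<le> dist p q"
      and diam: "\<And>p q. p \<in> P \<Longrightarrow> q \<in> P \<Longrightarrow> dist p q \<le> \<Delta>"
      using n(3) by auto
    define \<phi> where "\<phi> = c * real n powr (-1/3)"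
    \<comment> \<open>The exponent -1/3 is the balance point: the bracket in \<open>small\<close> is
      at most 3t, and \<phi> times t squared is constant.\<close>
    define t where "t = real n powr (1/6)"
    have t1: "1 \<le> t" using n by (simp add: t_def ge_one_powr_ge_zero)
    have \<phi>c: "\<phi> \<le> c"
      using c n powr_mono[of "-1/3" 0 "real n"] by (simp add: \<phi>_def mult_left_le)
    have \<phi>0: "0 < \<phi>" using c n by (simp add: \<phi>_def)
    have \<phi>t: "\<phi> * t\<^sup>2 = c"
      using n by (simp add: \<phi>_def t_def power2_eq_square flip: powr_add)
    have \<phi>n: "\<phi> * sqrt (real n) = c * t"
      using n by (simp add: \<phi>_def t_def powr_half_sqrt[symmetric] flip: powr_add)
    have "32 * \<phi> * \<Delta> / \<delta> = 32 * \<phi> * (\<Delta> / \<delta>)" by simp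
    also have "\<dots> \<le> 32 * \<phi> * (C * sqrt (real n))"
      using D \<phi>0 by (intro mult_left_mono) (auto simp: pos_divide_le_eq)
    also have "\<dots> = 32 * c * C * t" using \<phi>n by (simp add: algebra_simps)
    also have "\<dots> \<le> t" using cC t1 by (simp add: mult_left_le_one_le)
    finally have "32 * \<phi> * \<Delta> / \<delta> + 2 \<le> 3 * t" using t1 by simp
    then have "(32 * \<phi> * \<Delta> / \<delta> + 2)\<^sup>2 \<le> (3 * t)\<^sup>2"
      using D \<phi>0 by (intro power_mono) auto
    then have "65 * \<phi> * (32 * \<phi> * \<Delta> / \<delta> + 2)\<^sup>2 \<le> 65 * \<phi> * (3 * t)\<^sup>2"
      using \<phi>0 by (intro mult_left_mono) auto
    also have "\<dots> = 585 * c" by (simp add: power_mult_distrib flip: \<phi>t)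
    also have "\<dots> \<le> 1/2" using c by simp
    finally have "\<exists>f. stacking_order P f \<and> real (card P) * \<phi> / 2 \<le> vis P f"
      using n D \<phi>0 \<phi>c c sep diam by (intro ex_stacking_order_vis_ge[of P \<delta> \<Delta> \<phi>]) auto
    moreover have "real (card P) * \<phi> / 2 = c / 2 * real n powr (2/3)"
      using n powr_add[of "real n" 1 "-1/3"] by (simp add: \<phi>_def)
    ultimately show ?thesis by simp
  qed
  with c show "\<exists>C''::real. C'' > 0 \<and>
     (\<forall>(n::nat) (P::complex set). n > 0 \<longrightarrow> finite P \<longrightarrow> card P = n \<longrightarrow> C_dense C P \<longrightarrow>
        (\<exists>f. stacking_order P f \<and> vis P f \<ge> C'' * real n powr (2/3)))"
    by (intro exI[of _ "c / 2"]) auto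
qed

end
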